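(* $gr^3_2(B_6)=11$.
   Context: $K_n$ is the complete graph of order $n$. The book $B_n:=K_2+nK_1$ (graph join) is the graph on $n+2$ vertices consisting of an edge $xy$ (the spine) together with $n$ further, pairwise non-adjacent vertices (the pages), each adjacent to both $x$ and $y$. A $t$-coloring of $K_p$ is a map $f:E(K_p)\to\{1,\dots,t\}$, not assumed surjective. A Gallai $t$-coloring is a $t$-coloring with no rainbow triangle, i.e. there are no three vertices $x,y,z$ such that $f(xy),f(xz),f(yz)$ are pairwise distinct. For $1\le s<t$ and a graph $G$, the weakened Gallai-Ramsey number $gr^t_s(G)$ is the least $p\in\mathbb{N}$ such that every Gallai $t$-coloring of $K_p$ contains a (not necessarily induced) subgraph isomorphic to $G$ whose edges use at most $s$ colors. *)

theory Defs
  imports Main "HOL-Library.FuncSet"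
begin

type_synonym 'a graph = "'a set \<times> 'a set set"

definition verts :: "'a graph \<Rightarrow> 'a set" where
  "verts G = fst G"

definition edges :: "'a graph \<Rightarrow> 'a set set" where
  "edges G = snd G"

definition simple_graph :: "'a graph \<Rightarrow> bool" where
  "simple_graph G \<longleftrightarrow> (\<forall>e\<in>edges G. e \<subseteq> verts G \<and> card e = 2)"

definition subgraph :: "'a graph \<Rightarrow> 'a graph \<Rightarrow> bool" where
  "subgraph H G \<longleftrightarrow> simple_graph H \<and> verts H \<subseteq> verts G \<and> edges H \<subseteq> edges G"

definition graph_iso :: "'a graph \<Rightarrow> 'b graph \<Rightarrow> bool" where
  "graph_iso G H \<longleftrightarrow>
     (\<exists>\<phi>. bij_betw \<phi> (verts G) (verts H) \<and>
       (\<forall>u\<in>verts G. \<forall>v\<in>verts G. {u, v} \<in> edges G \<longleftrightarrow> {\<phi> u, \<phi> v} \<in> edges H))"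

definition complete_graph :: "nat \<Rightarrow> nat graph" where
  "complete_graph n = ({..<n}, {e. e \<subseteq> {..<n} \<and> card e = 2})"

definition copies :: "nat \<Rightarrow> 'a graph \<Rightarrow> (nat \<times> 'a) graph" where
  "copies n G = ({..<n} \<times> verts G, {Pair i ` e | i e. i < n \<and> e \<in> edges G})"

definition graph_join :: "'a graph \<Rightarrow> 'b graph \<Rightarrow> ('a + 'b) graph" where
  "graph_join G H =
     (verts G <+> verts H,
      (image Inl ` edges G) \<union> (image Inr ` edges H) \<union>
      {{Inl u, Inr v} | u v. u \<in> verts G \<and> v \<in> verts H})"

definition book :: "nat \<Rightarrow> (nat + nat \<times> nat) graph" where
  "book n = graph_join (complete_graph 2) (copies n (complete_graph 1))"

definition coloring :: "nat \<Rightarrow> nat \<Rightarrow> (nat set \<Rightarrow> nat) \<Rightarrow> bool" where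
  "coloring t p f \<longleftrightarrow> f \<in> edges (complete_graph p) \<rightarrow> {1..t}"

definition rainbow_triangle :: "nat \<Rightarrow> (nat set \<Rightarrow> nat) \<Rightarrow> bool" where
  "rainbow_triangle p f \<longleftrightarrow>
     (\<exists>x\<in>verts (complete_graph p). \<exists>y\<in>verts (complete_graph p). \<exists>z\<in>verts (complete_graph p).
        x \<noteq> y \<and> x \<noteq> z \<and> y \<noteq> z \<and>
        f {x, y} \<noteq> f {x, z} \<and> f {x, y} \<noteq> f {y, z} \<and> f {x, z} \<noteq> f {y, z})"

definition gallai_coloring :: "nat \<Rightarrow> nat \<Rightarrow> (nat set \<Rightarrow> nat) \<Rightarrow> bool" where
  "gallai_coloring t p f \<longleftrightarrow> coloring t p f \<and> \<not> rainbow_triangle p f"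

definition contains_with_colors :: "nat \<Rightarrow> nat \<Rightarrow> (nat set \<Rightarrow> nat) \<Rightarrow> 'a graph \<Rightarrow> bool" where
  "contains_with_colors s p f G \<longleftrightarrow>
     (\<exists>H. subgraph H (complete_graph p) \<and> graph_iso G H \<and> card (f ` edges H) \<le> s)"

(* Meaningful for 1 <= s < t.  LEAST is unspecified when no p qualifies, so an
   equation with a concrete value can only be proved if that value qualifies. *)
definition weakened_gallai_ramsey :: "nat \<Rightarrow> nat \<Rightarrow> 'a graph \<Rightarrow> nat" where
  "weakened_gallai_ramsey t s G =
     (LEAST p. \<forall>f. gallai_coloring t p f \<longrightarrow> contains_with_colors s p f G)"

lemma simple_graph_complete_graph: "simple_graph (complete_graph n)"
  by (auto simp: simple_graph_def complete_graph_def verts_def edges_def)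

lemma verts_book: "verts (book n) = {Inl 0, Inl 1} \<union> (\<lambda>i. Inr (i, 0)) ` {..<n}"
  by (auto simp: book_def graph_join_def complete_graph_def copies_def verts_def)

lemma edges_book:
  "edges (book n) =
     insert {Inl 0, Inl 1}
       ({{Inl 0, Inr (i, 0)} | i. i < n} \<union> {{Inl 1, Inr (i, 0)} | i. i < n})"
proof -
  have V2: "{..<2::nat} = {0, 1}" and V1: "{..<1::nat} = {0}" by auto
  have "e = {0, 1}" if "e \<subseteq> {0, 1}" "card e = 2" for e :: "nat set"
    using that card_subset_eq[of "{0, 1::nat}" e] by simp
  then have E2: "edges (complete_graph 2) = {{0, 1}}"
    unfolding complete_graph_def edges_def V2 by auto
  have "\<not> (e \<subseteq> {0} \<and> card e = 2)" for e :: "nat set"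
    by (auto simp: subset_singleton_iff)
  then have E1: "edges (complete_graph 1) = {}"
    unfolding complete_graph_def edges_def V1 by simp
  have "edges (book n) = insert {Inl 0, Inl 1}
      {{Inl u, Inr v} | u v. u \<in> {0, 1} \<and> v \<in> {..<n} \<times> {0}}"
    unfolding book_def graph_join_def edges_def[of "(_, _)"] snd_conv E2 copies_def E1
    by (simp add: verts_def complete_graph_def V2 V1 edges_def)
  then show ?thesis by blast
qed

lemma simple_graph_book: "simple_graph (book n)"
  unfolding simple_graph_def edges_book verts_book by auto

end

theory Submission
  imports Defs
begin

text \<open>
  A coloring avoids two-colored books with \<open>n\<close> pages iff every edge not colored \<open>k\<close> has at least
  \<open>p - 1 - n\<close> vertices joined to one of its ends in color \<open>k\<close>.
  For \<open>p = 10\<close> and \<open>n = 6\<close> this holds for two copies of the pentagon-pentagram coloring of \<open>K\<^sub>5\<close>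
  joined in a third color.
  For \<open>p = 11\<close>, some color class of a Gallai coloring is disconnected, and edges between two of its
  components all have the same color. Four components would force at least 12 vertices, and with at
  most three components two of the colors between them agree. Hence the vertices split into
  \<open>A\<close> and \<open>B\<close> with all cross edges of one color \<open>a\<close> and, say, at most five vertices in \<open>A\<close>.
  The condition forces \<open>A\<close> to be monochromatic in \<open>a\<close>, so every vertex of \<open>B\<close> has at least four
  neighbors in each of the other colors and at most two in color \<open>a\<close>, and the condition fails
  for \<open>k = a\<close> inside \<open>B\<close>.
\<close>

section \<open>Gallai colorings\<close>

text \<open>Allows any vertex set, so that an induction can remove a vertex.\<close>

definition rainbow_free :: "'a set \<Rightarrow> ('a set \<Rightarrow> 'c) \<Rightarrow> bool" where
  "rainbow_free V f \<longleftrightarrow>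
     (\<forall>x\<in>V. \<forall>y\<in>V. \<forall>z\<in>V. x \<noteq> y \<longrightarrow> x \<noteq> z \<longrightarrow> y \<noteq> z \<longrightarrow>
        f {x, y} = f {x, z} \<or> f {x, y} = f {y, z} \<or> f {x, z} = f {y, z})"

text \<open>Its reflexive transitive closure encodes lying in a common component of color class
  \<open>k\<close>.\<close>

definition color_rel :: "'a set \<Rightarrow> ('a set \<Rightarrow> 'c) \<Rightarrow> 'c \<Rightarrow> ('a \<times> 'a) set" where
  "color_rel V f k = {(x, y). x \<in> V \<and> y \<in> V \<and> x \<noteq> y \<and> f {x, y} = k}"

definition color_nbrs :: "'a set \<Rightarrow> ('a set \<Rightarrow> 'c) \<Rightarrow> 'c \<Rightarrow> 'a \<Rightarrow> 'a set" where
  "color_nbrs V f k x = {z \<in> V. z \<noteq> x \<and> f {x, z} = k}"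

lemma rainbow_freeD:
  assumes "rainbow_free V f" "x \<in> V" "y \<in> V" "z \<in> V" "x \<noteq> y" "x \<noteq> z" "y \<noteq> z"
  shows "f {x, y} = f {x, z} \<or> f {x, y} = f {y, z} \<or> f {x, z} = f {y, z}"
  using assms unfolding rainbow_free_def by blast

lemma rainbow_free_subset: "rainbow_free V f \<Longrightarrow> W \<subseteq> V \<Longrightarrow> rainbow_free W f"
  unfolding rainbow_free_def by blast

section \<open>Components of a color class\<close>

lemma sym_color_rel_rtrancl: "sym ((color_rel V f k)\<^sup>*)"
  by (intro sym_rtrancl) (auto simp: sym_def color_rel_def insert_commute)

lemma color_rel_rtrancl_sym: "(x, y) \<in> (color_rel V f k)\<^sup>* \<Longrightarrow> (y, x) \<in> (color_rel V f k)\<^sup>*"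
  using sym_color_rel_rtrancl by (rule symD)

lemma color_rel_rtrancl_in: "(x, y) \<in> (color_rel V f k)\<^sup>* \<Longrightarrow> x \<in> V \<Longrightarrow> y \<in> V"
  by (induction rule: rtrancl_induct) (auto simp: color_rel_def)

lemma color_neq_if_disconnected:
  assumes "(x, y) \<notin> (color_rel V f k)\<^sup>*" "x \<in> V" "y \<in> V"
  shows "x \<noteq> y" "f {x, y} \<noteq> k"
  using assms r_into_rtrancl[of "(x, y)" "color_rel V f k"] by (auto simp: color_rel_def)

text \<open>Walk from \<open>u\<close> to \<open>u'\<close>. At a step \<open>yz\<close> of color
  \<open>k\<close>, neither \<open>vy\<close> nor \<open>vz\<close> has color \<open>k\<close>, so
  these two must agree for the triangle not to be rainbow.\<close>

lemma color_constant_on_component: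
  assumes rf: "rainbow_free V f" and con: "(u, u') \<in> (color_rel V f k)\<^sup>*"
    and v: "v \<in> V" and u: "u \<in> V" and dis: "(v, u) \<notin> (color_rel V f k)\<^sup>*"
  shows "f {v, u'} = f {v, u}"
  using con
proof (induction rule: rtrancl_induct)
  case base
  show ?case ..
next
  case (step y z)
  have y: "y \<in> V" and z: "z \<in> V" and yz: "y \<noteq> z" "f {y, z} = k"
    using step.hyps(2) by (auto simp: color_rel_def)
  have "(u, z) \<in> (color_rel V f k)\<^sup>*"
    using step.hyps by simp
  then have dy: "(v, y) \<notin> (color_rel V f k)\<^sup>*" and dz: "(v, z) \<notin> (color_rel V f k)\<^sup>*"
    using dis step.hyps(1) by (meson color_rel_rtrancl_sym rtrancl_trans)+
  show ?case
    using rainbow_freeD[OF rf v y z] yz step.IH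
      color_neq_if_disconnected[OF dy v y] color_neq_if_disconnected[OF dz v z] by metis
qed

section \<open>Existence of a disconnected color class\<close>

lemma disconnected_if_color_missing_at:
  assumes "\<And>w. w \<in> V \<Longrightarrow> w \<noteq> v \<Longrightarrow> f {v, w} \<noteq> k" "w \<noteq> v"
  shows "(v, w) \<notin> (color_rel V f k)\<^sup>*"
proof
  assume "(v, w) \<in> (color_rel V f k)\<^sup>*"
  then obtain u where "(v, u) \<in> color_rel V f k"
    using assms(2) by (cases rule: converse_rtranclE) auto
  then show False using assms(1) by (auto simp: color_rel_def)
qed

text \<open>Each component of \<open>k\<close> in \<open>W\<close> is attached to \<open>v\<close>
  by an edge of color \<open>k\<close>. Hence an edge \<open>vw\<close> of another color passes its
  color on to every edge from \<open>w\<close> into other components, which allows two such edges to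
  be compared.\<close>

lemma other_color_at_connecting_vertex:
  assumes rf: "rainbow_free (insert v W) f" and v: "v \<notin> W"
    and x: "x \<in> W" and y: "y \<in> W" and xy: "(x, y) \<notin> (color_rel W f k)\<^sup>*"
    and con: "\<And>z. z \<in> W \<Longrightarrow> (z, v) \<in> (color_rel (insert v W) f k)\<^sup>*"
    and w: "w \<in> W" "f {v, w} \<noteq> k" and w': "w' \<in> W" "f {v, w'} \<noteq> k"
  shows "f {v, w} = f {v, w'}"
proof -
  let ?R = "(color_rel W f k)\<^sup>*"
  have rfW: "rainbow_free W f"
    using rf by (rule rainbow_free_subset) blast
  \<comment> \<open>The witness is the vertex from which a path from \<open>z\<close> first enters
    \<open>v\<close>; up to there the path stays in \<open>W\<close>.\<close>
  have reach: "z \<in> W \<Longrightarrow> \<exists>u\<in>W. (z, u) \<in> ?R \<and> f {v, u} = k" for z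
  proof -
    have "z \<in> W \<longrightarrow> (\<exists>u\<in>W. (z, u) \<in> ?R \<and> f {v, u} = k)"
      if "(z, v) \<in> (color_rel (insert v W) f k)\<^sup>*"
      using that
    proof (induction rule: converse_rtrancl_induct)
      case base
      then show ?case using v by blast
    next
      case (step z z')
      show ?case
      proof (cases "z' = v")
        case True
        then show ?thesis using step.hyps(1) by (auto simp: color_rel_def insert_commute)
      next
        case False
        then have "z \<in> W \<Longrightarrow> (z, z') \<in> color_rel W f k" "z' \<in> W"
          using step.hyps(1) by (auto simp: color_rel_def)
        then show ?thesis using step.IH by (meson converse_rtrancl_into_rtrancl)
      qed
    qed
    then show "z \<in> W \<Longrightarrow> \<exists>u\<in>W. (z, u) \<in> ?R \<and> f {v, u} = k" using con by blast
  qed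
  have color: "f {w, z} = f {v, w}"
    if w: "w \<in> W" "f {v, w} \<noteq> k" and z: "z \<in> W" "(w, z) \<notin> ?R" for w z
  proof -
    obtain u where u: "u \<in> W" "(z, u) \<in> ?R" "f {v, u} = k"
      using reach z by blast
    have wu: "(w, u) \<notin> ?R"
      using u(2) z(2) by (meson color_rel_rtrancl_sym rtrancl_trans)
    \<comment> \<open>In the triangle \<open>v\<close>, \<open>w\<close>, \<open>u\<close> only
      \<open>vu\<close> has color \<open>k\<close>, so the other two edges agree.\<close>
    have "f {w, u} = f {v, w}"
      using rainbow_freeD[OF rf, of v w u] v w u color_neq_if_disconnected[OF wu w(1) u(1)]
      by (metis insertCI)
    moreover have "f {w, u} = f {w, z}"
      by (rule color_constant_on_component[OF rfW u(2) w(1) z])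
    ultimately show ?thesis by simp
  qed
  show ?thesis
  proof (cases "(w, w') \<in> ?R")
    case False
    then have "(w', w) \<notin> ?R" using color_rel_rtrancl_sym by fast
    then show ?thesis
      using color[OF w w'(1) False] color[OF w' w(1)] by (simp add: insert_commute)
  next
    case True
    \<comment> \<open>One of \<open>x\<close>, \<open>y\<close> lies outside the common component of
      \<open>w\<close> and \<open>w'\<close>; its edges to \<open>w\<close> and \<open>w'\<close>
      have the same color.\<close>
    obtain z where z: "z \<in> W" "(w, z) \<notin> ?R"
      using x y xy by (meson color_rel_rtrancl_sym rtrancl_trans)
    have z': "(w', z) \<notin> ?R" and zw: "(z, w) \<notin> ?R"
      using z(2) True by (meson color_rel_rtrancl_sym rtrancl_trans)+
    show ?thesis
      using color[OF w z] color[OF w' z(1) z']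
        color_constant_on_component[OF rfW True z(1) w(1) zw] by (simp add: insert_commute)
  qed
qed

text \<open>Induction on the vertices. If \<open>v\<close> connects the color \<open>k\<close> that
  is disconnected on \<open>W\<close>, the edges at \<open>v\<close> use at most \<open>k\<close>
  and one more color, so a third color of \<open>K\<close> is missing at \<open>v\<close> and
  isolates it. Colors of \<open>K\<close> that never occur count as disconnected.\<close>

theorem rainbow_free_disconnected_color:
  assumes "finite V" "card V \<ge> 2" "rainbow_free V f" "card K \<ge> 3"
    "\<And>x y. x \<in> V \<Longrightarrow> y \<in> V \<Longrightarrow> x \<noteq> y \<Longrightarrow> f {x, y} \<in> K"
  shows "\<exists>k\<in>K. \<exists>x\<in>V. \<exists>y\<in>V. (x, y) \<notin> (color_rel V f k)\<^sup>*"
  using assms(1-3,5)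
proof (induction V rule: finite_induct)
  case empty
  then show ?case by simp
next
  case (insert v W)
  have spare: "\<exists>k'\<in>K. k' \<noteq> a \<and> k' \<noteq> b" for a b
  proof -
    have "\<not> K \<subseteq> {a, b}"
      using \<open>card K \<ge> 3\<close> card_mono[of "{a, b}" K] card_length[of "[a, b]"] by auto
    then show ?thesis by blast
  qed
  have "card W \<ge> 1" using insert.prems(1) insert.hyps by simp
  then obtain w where w: "w \<in> W" by fastforce
  then have wv: "w \<noteq> v" using insert.hyps by blast
  have missing: ?case if "\<And>u. u \<in> W \<Longrightarrow> f {v, u} = a \<or> f {v, u} = b" for a b
  proof -
    obtain k' where k': "k' \<in> K" "k' \<noteq> a" "k' \<noteq> b" using spare by blast
    then have "(v, w) \<notin> (color_rel (insert v W) f k')\<^sup>*"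
      using that wv by (intro disconnected_if_color_missing_at) auto
    then show ?thesis using k' w by blast
  qed
  show ?case
  proof (cases "card W = 1")
    case True
    then have "W = {w}" using w by (auto simp: card_Suc_eq)
    then show ?thesis using missing[of "f {v, w}" "f {v, w}"] by simp
  next
    case False
    then have "card W \<ge> 2" using \<open>card W \<ge> 1\<close> by simp
    moreover have "rainbow_free W f"
      using insert.prems(2) by (rule rainbow_free_subset) blast
    ultimately obtain k x y where k: "k \<in> K" "x \<in> W" "y \<in> W" "(x, y) \<notin> (color_rel W f k)\<^sup>*"
      using insert.IH insert.prems(3) by blast
    show ?thesis
    proof (rule ccontr)
      assume no: "\<not> ?thesis"
      then have con: "\<And>z. z \<in> W \<Longrightarrow> (z, v) \<in> (color_rel (insert v W) f k)\<^sup>*"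
        using k(1) by blast
      note eq = other_color_at_connecting_vertex[OF insert.prems(2) insert.hyps(2) k(2-4) con]
      obtain a where "\<And>u. u \<in> W \<Longrightarrow> f {v, u} = k \<or> f {v, u} = a"
        using eq by metis
      then show False using missing no by blast
    qed
  qed
qed

section \<open>Two-colored books\<close>

text \<open>Possible pages on the spine \<open>xy\<close> when color \<open>k\<close> is forbidden;
  the color of the spine itself is a separate condition below.\<close>

definition book_pages :: "nat \<Rightarrow> (nat set \<Rightarrow> nat) \<Rightarrow> nat \<Rightarrow> nat \<Rightarrow> nat \<Rightarrow> nat set" where
  "book_pages p f k x y = {z. z < p \<and> z \<noteq> x \<and> z \<noteq> y \<and> f {x, z} \<noteq> k \<and> f {y, z} \<noteq> k}"

lemma finite_book_pages [simp]: "finite (book_pages p f k x y)"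
  unfolding book_pages_def by simp

lemma edge_complete_graph_iff: "{x, y} \<in> edges (complete_graph p) \<longleftrightarrow> x < p \<and> y < p \<and> x \<noteq> y"
  by (cases "x = y") (auto simp: edges_def complete_graph_def)

text \<open>A copy with at most \<open>s\<close> of the \<open>s + 1\<close> colors misses some
  \<open>k\<close>; the isomorphism carries its pages into \<open>book_pages\<close> for that
  \<open>k\<close>.\<close>

lemma book_pages_if_contains:
  assumes col: "coloring (Suc s) p f" and cont: "contains_with_colors s p f (book n)"
  shows "\<exists>x<p. \<exists>y<p. \<exists>k\<in>{1..Suc s}. x \<noteq> y \<and> f {x, y} \<noteq> k \<and> n \<le> card (book_pages p f k x y)"
proof -
  obtain H where H: "subgraph H (complete_graph p)" and iso: "graph_iso (book n) H"
    and cs: "card (f ` edges H) \<le> s"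
    using cont unfolding contains_with_colors_def by blast
  obtain \<phi> where bij: "bij_betw \<phi> (verts (book n)) (verts H)"
    and ed: "\<And>u v. u \<in> verts (book n) \<Longrightarrow> v \<in> verts (book n) \<Longrightarrow>
      {u, v} \<in> edges (book n) \<longleftrightarrow> {\<phi> u, \<phi> v} \<in> edges H"
    using iso unfolding graph_iso_def by blast
  have sub: "edges H \<subseteq> edges (complete_graph p)"
    using H unfolding subgraph_def by blast
  have "\<not> {1..Suc s} \<subseteq> f ` edges H"
  proof
    assume "{1..Suc s} \<subseteq> f ` edges H"
    moreover have "f ` edges H \<subseteq> {1..Suc s}"
      using col sub unfolding coloring_def by blast
    ultimately have "f ` edges H = {1..Suc s}" by simp
    then show False using cs by simp
  qed
  then obtain k where k: "k \<in> {1..Suc s}" "k \<notin> f ` edges H" by blast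
  let ?x = "\<phi> (Inl 0)" and ?y = "\<phi> (Inl 1)" and ?z = "\<lambda>i. \<phi> (Inr (i, 0))"
  have good: "{u, v} \<in> edges (complete_graph p) \<and> f {u, v} \<noteq> k" if "{u, v} \<in> edges H" for u v
    using that sub k(2) by blast
  have xy: "{?x, ?y} \<in> edges H"
    using ed[of "Inl 0" "Inl 1"] by (simp add: verts_book edges_book)
  have xz: "{?x, ?z i} \<in> edges H" if "i < n" for i
    using that ed[of "Inl 0" "Inr (i, 0)"] by (auto simp: verts_book edges_book)
  have yz: "{?y, ?z i} \<in> edges H" if "i < n" for i
    using that ed[of "Inl 1" "Inr (i, 0)"] by (auto simp: verts_book edges_book)
  have "inj_on \<phi> (verts (book n))"
    using bij by (rule bij_betw_imp_inj_on)
  then have "inj_on ?z {..<n}"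
    unfolding inj_on_def verts_book by blast
  moreover have "?z ` {..<n} \<subseteq> book_pages p f k ?x ?y"
  proof
    fix z assume "z \<in> ?z ` {..<n}"
    then obtain i where i: "i < n" "z = ?z i" by blast
    show "z \<in> book_pages p f k ?x ?y"
      using good[OF xz[OF i(1)]] good[OF yz[OF i(1)]] i(2)
      unfolding edge_complete_graph_iff book_pages_def by auto
  qed
  ultimately have "n \<le> card (book_pages p f k ?x ?y)"
    using card_inj_on_le[of ?z "{..<n}"] by simp
  then show ?thesis
    using good[OF xy] k(1) unfolding edge_complete_graph_iff by blast
qed

text \<open>The copy is the image of \<open>book n\<close> under an explicit injective map. Its
  edges avoid \<open>k\<close>, which leaves \<open>s\<close> colors.\<close>

lemma contains_if_book_pages:
  assumes col: "coloring (Suc s) p f" and x: "x < p" and y: "y < p" and k: "k \<in> {1..Suc s}"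
    and xy: "x \<noteq> y" "f {x, y} \<noteq> k" and n: "n \<le> card (book_pages p f k x y)"
  shows "contains_with_colors s p f (book n)"
proof -
  obtain Z where Z: "Z \<subseteq> book_pages p f k x y" "card Z = n" "finite Z"
    using obtain_subset_with_card_n[OF n] by blast
  obtain h where h: "bij_betw h {..<n} Z"
    using ex_bij_betw_nat_finite[OF Z(3)] Z(2) by (auto simp: atLeast0LessThan)
  have hZ: "i < n \<Longrightarrow> h i \<in> book_pages p f k x y" for i
    using h Z(1) by (auto simp: bij_betw_def)
  define \<phi> :: "nat + nat \<times> nat \<Rightarrow> nat" where
    "\<phi> = case_sum (\<lambda>u. if u = 0 then x else y) (\<lambda>v. h (fst v))"
  have \<phi>: "\<phi> (Inl 0) = x" "\<phi> (Inl (Suc 0)) = y" "\<And>i. \<phi> (Inr (i, 0)) = h i"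
    by (simp_all add: \<phi>_def)
  have inj: "inj_on \<phi> (verts (book n))"
  proof -
    have "inj_on h {..<n}" using h by (rule bij_betw_imp_inj_on)
    then show ?thesis
      using hZ xy(1) by (fastforce simp: inj_on_def verts_book \<phi> book_pages_def)
  qed
  define H where "H = (\<phi> ` verts (book n), image \<phi> ` edges (book n))"
  have VH: "verts H = \<phi> ` verts (book n)" and EH: "edges H = image \<phi> ` edges (book n)"
    by (simp_all add: H_def verts_def edges_def)
  have edge: "\<exists>u v. e = {u, v} \<and> u < p \<and> v < p \<and> u \<noteq> v \<and> f {u, v} \<noteq> k"
    if e: "e \<in> edges H" for e
  proof -
    consider "e = {x, y}" | i where "i < n" "e = {x, h i}" | i where "i < n" "e = {y, h i}"
      using e unfolding EH edges_book by (auto simp: \<phi>)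
    then show ?thesis
    proof cases
      case 1
      then show ?thesis using x y xy by blast
    next
      case (2 i)
      then have "h i < p" "x \<noteq> h i" "f {x, h i} \<noteq> k"
        using hZ[OF 2(1)] by (auto simp: book_pages_def)
      then show ?thesis using x 2(2) by blast
    next
      case (3 i)
      then have "h i < p" "y \<noteq> h i" "f {y, h i} \<noteq> k"
        using hZ[OF 3(1)] by (auto simp: book_pages_def)
      then show ?thesis using y 3(2) by blast
    qed
  qed
  have sub: "edges H \<subseteq> edges (complete_graph p)"
    using edge by (metis edge_complete_graph_iff subsetI)
  have "subgraph H (complete_graph p)"
  proof -
    have "e \<subseteq> verts H" if "e \<in> edges H" for e
      using that simple_graph_book[of n] unfolding VH EH simple_graph_def by blast
    moreover have "card e = 2" if "e \<in> edges H" for e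
      using that sub by (auto simp: edges_def complete_graph_def)
    moreover have "verts H \<subseteq> verts (complete_graph p)"
      using x y hZ unfolding VH verts_book
      by (auto simp: \<phi> book_pages_def verts_def complete_graph_def)
    ultimately show ?thesis
      using sub unfolding subgraph_def simple_graph_def by blast
  qed
  moreover have "graph_iso (book n) H"
  proof -
    have "{u, v} \<in> edges (book n) \<longleftrightarrow> {\<phi> u, \<phi> v} \<in> edges H"
      if "u \<in> verts (book n)" "v \<in> verts (book n)" for u v
    proof -
      \<comment> \<open>Edges are also reflected, since taking images under an injective map is
        injective on subsets of its domain.\<close>
      have "edges (book n) \<subseteq> Pow (verts (book n))"
        using simple_graph_book[of n] unfolding simple_graph_def by blast
      then have "\<phi> ` {u, v} \<in> image \<phi> ` edges (book n) \<longleftrightarrow> {u, v} \<in> edges (book n)"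
        using that inj_on_image_mem_iff[OF inj_on_image_Pow[OF inj], of "{u, v}"] by blast
      then show ?thesis unfolding EH by simp
    qed
    then show ?thesis
      using inj unfolding graph_iso_def VH by (blast intro: inj_on_imp_bij_betw)
  qed
  moreover have "card (f ` edges H) \<le> s"
  proof -
    have "f ` edges H \<subseteq> {1..Suc s}"
      using sub col unfolding coloring_def by blast
    moreover have "k \<notin> f ` edges H" using edge by blast
    ultimately have "f ` edges H \<subseteq> {1..Suc s} - {k}" by blast
    then have "card (f ` edges H) \<le> card ({1..Suc s} - {k})"
      by (intro card_mono) auto
    then show ?thesis using k by simp
  qed
  ultimately show ?thesis unfolding contains_with_colors_def by blast
qed

text \<open>Each vertex other than \<open>x\<close> and \<open>y\<close> is a page or is joined to
  one of them in color \<open>k\<close>. At most \<open>n - 1\<close> pages leave at least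
  \<open>p - 2 - (n - 1)\<close> such neighbors.\<close>

lemma card_color_nbrs_if_no_book:
  assumes col: "coloring (Suc s) p f" and no: "\<not> contains_with_colors s p f (book n)"
    and "x < p" "y < p" "k \<in> {1..Suc s}" "x \<noteq> y" "f {x, y} \<noteq> k"
  shows "p \<le> card (color_nbrs {..<p} f k x \<union> color_nbrs {..<p} f k y) + n + 1"
proof -
  let ?N = "color_nbrs {..<p} f k x \<union> color_nbrs {..<p} f k y"
  have "card (book_pages p f k x y) < n"
    using contains_if_book_pages[OF col assms(3-7)] no by (meson not_le)
  moreover have "{..<p} \<subseteq> {x, y} \<union> book_pages p f k x y \<union> ?N"
    by (auto simp: book_pages_def color_nbrs_def)
  then have "card {..<p} \<le> card ({x, y} \<union> book_pages p f k x y \<union> ?N)"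
    by (intro card_mono) (auto simp: color_nbrs_def)
  moreover have "card ({x, y} \<union> book_pages p f k x y \<union> ?N)
      \<le> card {x, y} + card (book_pages p f k x y) + card ?N"
    by (meson add_le_mono card_Un_le le_refl le_trans)
  ultimately show ?thesis using \<open>x \<noteq> y\<close> by simp
qed

section \<open>Eleven vertices\<close>

text \<open>A hypothetical counterexample, to be refuted. The bound 4 in \<open>nbrs\<close> is
  \<open>11 - 1 - 6\<close>.\<close>

locale three_coloring_11 =
  fixes V :: "'a set" and f :: "'a set \<Rightarrow> 'c" and K :: "'c set"
  assumes card_V: "card V = 11" and card_K: "card K = 3"
    and color_in: "\<And>x y. x \<in> V \<Longrightarrow> y \<in> V \<Longrightarrow> x \<noteq> y \<Longrightarrow> f {x, y} \<in> K"
    and rf: "rainbow_free V f"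
    and nbrs: "\<And>x y k. x \<in> V \<Longrightarrow> y \<in> V \<Longrightarrow> x \<noteq> y \<Longrightarrow> k \<in> K \<Longrightarrow> f {x, y} \<noteq> k \<Longrightarrow>
      4 \<le> card (color_nbrs V f k x \<union> color_nbrs V f k y)"
begin

abbreviation "N \<equiv> color_nbrs V f"

lemma finite_V: "finite V"
  using card_V by (intro card_ge_0_finite) simp

lemma finite_N [simp]: "finite (N k x)"
  using finite_V by (simp add: color_nbrs_def)

section \<open>Cuts in a single color\<close>

lemma monochromatic_cut_aux:
  assumes AB: "A \<union> B = V" "A \<inter> B = {}" "A \<noteq> {}" and A5: "card A \<le> 5"
    and cut: "\<And>x y. x \<in> A \<Longrightarrow> y \<in> B \<Longrightarrow> f {x, y} = a"
  shows False
proof -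
  have fin: "finite A" "finite B" using AB(1) finite_V by (metis finite_Un)+
  have "card A + card B = 11"
    using card_Un_disjoint[OF fin AB(2)] AB(1) card_V by simp
  then have "B \<noteq> {}" using A5 by auto
  then obtain x0 y0 where x0: "x0 \<in> A" and y0: "y0 \<in> B" using AB(3) by blast
  have "a \<in> K" using color_in[of x0 y0] cut[OF x0 y0] x0 y0 AB by blast
  then have "card (K - {a}) = 2" using card_K by simp
  then obtain b c where "K - {a} = {b, c}" and bc: "b \<noteq> c" by (auto simp: card_2_iff)
  then have K: "K = {a, b, c}" "a \<noteq> b" "a \<noteq> c" using \<open>a \<in> K\<close> by auto
  have inA: "f {x, y} = a" if x: "x \<in> A" and y: "y \<in> A" and xy: "x \<noteq> y" for x y
  proof (rule ccontr)
    assume na: "f {x, y} \<noteq> a"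
    \<comment> \<open>Edges of color \<open>k\<close> do not cross the cut, so the
      \<open>k\<close>-neighbors of \<open>x\<close> and \<open>y\<close> lie among the at most
      three other vertices of \<open>A\<close>.\<close>
    obtain k where k: "k \<in> K" "k \<noteq> a" "f {x, y} \<noteq> k"
      using K bc by (cases "f {x, y} = b") auto
    have "z \<in> A" if "z \<in> N k w" "w \<in> A" for z w
      using that k(2) cut AB(1) unfolding color_nbrs_def by blast
    then have "N k x \<union> N k y \<subseteq> A - {x, y}"
      using x y k(3) by (auto simp: color_nbrs_def insert_commute)
    then have "card (N k x \<union> N k y) \<le> card (A - {x, y})"
      using fin by (intro card_mono) auto
    moreover have "card (A - {x, y}) \<le> 3"
      using A5 x y xy fin by (simp add: card_Diff_subset)
    moreover have "4 \<le> card (N k x \<union> N k y)"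
      using nbrs x y xy k AB(1) by blast
    ultimately show False by simp
  qed
  have noA: "N k x = {}" if "x \<in> A" "k \<noteq> a" for x k
    using that inA cut AB(1) by (auto simp: color_nbrs_def)
  \<comment> \<open>In the pair \<open>x0\<close>, \<open>y\<close> all required
    \<open>k\<close>-neighbors belong to \<open>y\<close>, because \<open>x0\<close> has
    none.\<close>
  have degB: "4 \<le> card (N k y)" if y: "y \<in> B" and k: "k \<in> K" "k \<noteq> a" for y k
    using nbrs[of x0 y k] noA[OF x0 k(2)] cut[OF x0 y] x0 y k AB by auto
  have deg_a: "card (N a y) \<le> 2" if y: "y \<in> B" for y
  proof -
    have "card (N a y \<union> N b y \<union> N c y) = card (N a y) + card (N b y) + card (N c y)"
    proof -
      have "N a y \<inter> N b y = {}" "(N a y \<union> N b y) \<inter> N c y = {}"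
        using K bc by (auto simp: color_nbrs_def)
      then show ?thesis by (simp add: card_Un_disjoint)
    qed
    moreover have "N a y \<union> N b y \<union> N c y \<subseteq> V - {y}" by (auto simp: color_nbrs_def)
    then have "card (N a y \<union> N b y \<union> N c y) \<le> card (V - {y})"
      using finite_V by (intro card_mono) auto
    moreover have "card (V - {y}) = 10" using y AB(1) card_V by auto
    moreover have "4 \<le> card (N b y)" "4 \<le> card (N c y)" using degB[OF y] K by auto
    ultimately show ?thesis by simp
  qed
  \<comment> \<open>The spine \<open>y0\<close>, \<open>y1\<close> of color \<open>b\<close>
    violates the condition for \<open>a\<close>: both \<open>a\<close>-neighborhoods have at most
    two elements and share \<open>x0\<close>, so their union has at most three.\<close>
  have "4 \<le> card (N b y0)" using degB[OF y0] K by auto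
  then obtain y1 where "y1 \<in> N b y0" by fastforce
  then have y1: "y1 \<in> V" "y1 \<noteq> y0" "f {y0, y1} = b" by (auto simp: color_nbrs_def)
  then have "y1 \<in> B" using cut[OF _ y0, of y1] AB(1) K by (auto simp: insert_commute)
  have "4 \<le> card (N a y0 \<union> N a y1)"
    using nbrs[of y0 y1 a] y0 y1 AB(1) K by auto
  moreover have "x0 \<in> N a y0 \<inter> N a y1"
    using x0 y0 \<open>y1 \<in> B\<close> cut AB by (auto simp: color_nbrs_def insert_commute)
  then have "card (N a y0 \<inter> N a y1) \<noteq> 0" by auto
  moreover have "card (N a y0) + card (N a y1)
      = card (N a y0 \<union> N a y1) + card (N a y0 \<inter> N a y1)"
    by (rule card_Un_Int) simp_all
  ultimately show False using deg_a[OF y0] deg_a[OF \<open>y1 \<in> B\<close>] by simp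
qed

text \<open>One side of a cut of eleven vertices has at most five, and the situation is symmetric in
  the sides.\<close>

lemma no_monochromatic_cut:
  assumes AB: "A \<union> B = V" "A \<inter> B = {}" "A \<noteq> {}" "B \<noteq> {}"
    and cut: "\<And>x y. x \<in> A \<Longrightarrow> y \<in> B \<Longrightarrow> f {x, y} = a"
  shows False
proof (cases "card A \<le> 5")
  case True
  then show ?thesis using monochromatic_cut_aux[OF AB(1-3) _ cut] by blast
next
  case False
  have fin: "finite A" "finite B" using AB(1) finite_V by (metis finite_Un)+
  have "card A + card B = 11"
    using card_Un_disjoint[OF fin AB(2)] AB(1) card_V by simp
  then have "card B \<le> 5" using False by simp
  moreover have "f {y, x} = a" if "y \<in> B" "x \<in> A" for x y
    using cut[OF that(2,1)] by (simp add: insert_commute)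
  ultimately show ?thesis
    using monochromatic_cut_aux[of B A a] AB by blast
qed

text \<open>Pairing up the four representatives gives at least \<open>4 + 4\<close> neighbors of
  color \<open>k\<close>. Different components make the closed neighborhoods disjoint, so there
  would be at least 12 vertices.\<close>

lemma at_most_three_components:
  assumes k: "k \<in> K" and X: "X \<subseteq> V" "card X = 4"
    and dis: "\<And>x y. x \<in> X \<Longrightarrow> y \<in> X \<Longrightarrow> x \<noteq> y \<Longrightarrow> (x, y) \<notin> (color_rel V f k)\<^sup>*"
  shows False
proof -
  have finX: "finite X" using X(2) by (intro card_ge_0_finite) simp
  let ?M = "\<lambda>x. insert x (N k x)"
  have M: "(x, z) \<in> (color_rel V f k)\<^sup>*" if "x \<in> X" "z \<in> ?M x" for x z
    using that X(1) by (auto simp: color_nbrs_def color_rel_def intro: r_into_rtrancl)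
  have "card (\<Union>x\<in>X. ?M x) = (\<Sum>x\<in>X. card (?M x))"
  proof (rule card_UN_disjoint[OF finX])
    show "\<forall>x\<in>X. finite (?M x)" by simp
    show "\<forall>x\<in>X. \<forall>y\<in>X. x \<noteq> y \<longrightarrow> ?M x \<inter> ?M y = {}"
      using M dis by (meson color_rel_rtrancl_sym disjoint_iff rtrancl_trans)
  qed
  moreover have "card (?M x) = card (N k x) + 1" for x
    using card_insert_disjoint[OF finite_N, of x k x] by (simp add: color_nbrs_def)
  then have "(\<Sum>x\<in>X. card (?M x)) = (\<Sum>x\<in>X. card (N k x)) + 4"
    using X(2) by (simp only: sum.distrib sum_constant) simp
  moreover have "card (\<Union>x\<in>X. ?M x) \<le> 11"
    using X(1) finite_V by (subst card_V[symmetric]) (intro card_mono, auto simp: color_nbrs_def)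
  moreover have "8 \<le> (\<Sum>x\<in>X. card (N k x))"
  proof -
    have pair: "4 \<le> card (N k x) + card (N k y)" if "x \<in> X" "y \<in> X" "x \<noteq> y" for x y
    proof -
      have "4 \<le> card (N k x \<union> N k y)"
        using nbrs[of x y k] color_neq_if_disconnected(2)[OF dis] that X(1) k by blast
      then show ?thesis using card_Un_le[of "N k x" "N k y"] by simp
    qed
    obtain x1 x2 x3 x4 where "X = {x1, x2, x3, x4}" "distinct [x1, x2, x3, x4]"
      using X(2) by (auto simp: numeral_eq_Suc card_Suc_eq)
    then show ?thesis using pair[of x1 x2] pair[of x3 x4] by simp
  qed
  ultimately show False by simp
qed

lemma inconsistent: False
proof -
  obtain k x y where k: "k \<in> K" and x: "x \<in> V" and y: "y \<in> V"
    and xy: "(x, y) \<notin> (color_rel V f k)\<^sup>*"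
    using rainbow_free_disconnected_color[OF finite_V _ rf, of K] card_V card_K color_in by auto
  let ?R = "(color_rel V f k)\<^sup>*"
  have const: "f {v, w} = f {x, y}"
    if "(x, v) \<in> ?R" "(y, w) \<in> ?R" "x \<in> V" "y \<in> V" "(x, y) \<notin> ?R" for x y v w
  proof -
    have v: "v \<in> V" using color_rel_rtrancl_in that by fast
    have "(y, x) \<notin> ?R" "(v, y) \<notin> ?R"
      using that by (meson color_rel_rtrancl_sym rtrancl_trans)+
    then show ?thesis
      using color_constant_on_component[OF rf that(2) v that(4)]
        color_constant_on_component[OF rf that(1,4,3)] by (simp add: insert_commute)
  qed
  \<comment> \<open>By \<open>const\<close>, a single color \<open>a\<close> from \<open>u\<close>
    to all other components makes the component of \<open>u\<close> one side of a cut in color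
    \<open>a\<close>.\<close>
  have comp_cut: False
    if u: "u \<in> V" "w \<in> V" "(u, w) \<notin> ?R"
      and cut: "\<And>z. z \<in> V \<Longrightarrow> (u, z) \<notin> ?R \<Longrightarrow> f {u, z} = a" for u w a
  proof (rule no_monochromatic_cut)
    show "{z \<in> V. (u, z) \<in> ?R} \<union> {z \<in> V. (u, z) \<notin> ?R} = V" by blast
    show "f {v, z} = a" if "v \<in> {z \<in> V. (u, z) \<in> ?R}" "z \<in> {z \<in> V. (u, z) \<notin> ?R}" for v z
      using that const[of u v z z] cut[of z] u(1) by auto
  qed (use u in auto)
  show False
  proof (cases "\<exists>z\<in>V. (x, z) \<notin> ?R \<and> (y, z) \<notin> ?R")
    case False
    then have "f {x, z} = f {x, y}" if "z \<in> V" "(x, z) \<notin> ?R" for z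
      using that const[of x x y z] x y xy by blast
    then show ?thesis using comp_cut[OF x y xy] by blast
  next
    case True
    then obtain z where z: "z \<in> V" and xz: "(x, z) \<notin> ?R" and yz: "(y, z) \<notin> ?R" by blast
    have cover: "(x, w) \<in> ?R \<or> (y, w) \<in> ?R \<or> (z, w) \<in> ?R" if w: "w \<in> V" for w
    proof (rule ccontr)
      assume n: "\<not> ?thesis"
      have "distinct [x, y, z, w]" using xy xz yz n by auto
      then have "card {x, y, z, w} = 4" by simp
      moreover have "(u, v) \<notin> ?R" if "u \<in> {x, y, z, w}" "v \<in> {x, y, z, w}" "u \<noteq> v" for u v
        using that n xy xz yz color_rel_rtrancl_sym[of _ _ V f k] by blast
      ultimately show False
        using at_most_three_components[OF k, of "{x, y, z, w}"] x y z w by blast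
    qed
    have split: False
      if u: "u \<in> V" "v \<in> V" "w \<in> V" "(u, v) \<notin> ?R" "(u, w) \<notin> ?R"
        and cov: "\<And>t. t \<in> V \<Longrightarrow> (u, t) \<in> ?R \<or> (v, t) \<in> ?R \<or> (w, t) \<in> ?R"
        and eq: "f {u, v} = f {u, w}" for u v w
    proof (rule comp_cut[OF u(1,2,4)])
      show "f {u, t} = f {u, v}" if "t \<in> V" "(u, t) \<notin> ?R" for t
        using that cov[of t] const[of u u v t] const[of u u w t] u eq by auto
    qed
    have ne: "x \<noteq> y" "x \<noteq> z" "y \<noteq> z" using xy xz yz by auto
    have yx: "(y, x) \<notin> ?R" and zx: "(z, x) \<notin> ?R" and zy: "(z, y) \<notin> ?R"
      using xy xz yz color_rel_rtrancl_sym by fast+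
    show ?thesis
      \<comment> \<open>Two edges of the triangle of representatives agree, and the component of
        their common end is cut off in that color.\<close>
      using rainbow_freeD[OF rf x y z ne]
        split[OF x y z xy xz] split[OF y x z yx yz] split[OF z x y zx zy] cover
      by (auto simp: insert_commute)
  qed
qed

end

section \<open>Transfer to colorings of the complete graph\<close>

lemma rainbow_free_if_gallai:
  assumes "gallai_coloring t p f"
  shows "rainbow_free {..<p} f"
proof -
  have "verts (complete_graph p) = {..<p}"
    by (simp add: verts_def complete_graph_def)
  then show ?thesis
    using assms unfolding gallai_coloring_def rainbow_triangle_def rainbow_free_def by metis
qed

lemma contains_book_if_gallai_11:
  assumes g: "gallai_coloring 3 11 f"
  shows "contains_with_colors 2 11 f (book 6)"
proof (rule ccontr)
  assume no: "\<not> contains_with_colors 2 11 f (book 6)"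
  have col: "coloring (Suc 2) 11 f" using g by (simp add: gallai_coloring_def)
  interpret three_coloring_11 "{..<11::nat}" f "{1..3}"
  proof
    show "f {x, y} \<in> {1..3}" if "x \<in> {..<11}" "y \<in> {..<11}" "x \<noteq> y" for x y
    proof -
      have "{x, y} \<in> edges (complete_graph 11)"
        using that by (simp add: edge_complete_graph_iff)
      then show ?thesis using col by (auto simp: coloring_def)
    qed
    show "4 \<le> card (color_nbrs {..<11} f k x \<union> color_nbrs {..<11} f k y)"
      if "x \<in> {..<11}" "y \<in> {..<11}" "x \<noteq> y" "k \<in> {1..3}" "f {x, y} \<noteq> k" for x y k
      using card_color_nbrs_if_no_book[OF col no, of x y k] that by simp
  qed (simp_all add: rainbow_free_if_gallai[OF g])
  show False by (rule inconsistent)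
qed

section \<open>Ten vertices\<close>

text \<open>Color 1 joins the two blocks. In a block of five, color 2 is the pentagon of differences
  1 and 4, and color 3 the complementary pentagram.\<close>

definition pentagon_color :: "nat \<Rightarrow> nat \<Rightarrow> nat" where
  "pentagon_color x y =
     (if (x < 5) \<noteq> (y < 5) then 1 else if (y - x) mod 5 \<in> {1, 4} then 2 else 3)"

text \<open>\<open>Min\<close> and \<open>Max\<close> order the ends, so that the truncated
  subtraction in \<open>pentagon_color\<close> is the true difference.\<close>

definition double_pentagon :: "nat set \<Rightarrow> nat" where
  "double_pentagon e = pentagon_color (Min e) (Max e)"

lemma double_pentagon_pair: "double_pentagon {x, y} = pentagon_color (min x y) (max x y)"
  by (cases "x \<le> y") (simp_all add: double_pentagon_def min_def max_def)

lemma double_pentagon_in: "double_pentagon e \<in> {1..3}"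
  by (simp add: double_pentagon_def pentagon_color_def)

text \<open>A finite check over lists, hence executable. The page counts are 3 for
  \<open>k = 1\<close>; for other \<open>k\<close> they are 4 if the spine joins the blocks and 5 if
  it lies in one.\<close>

lemma double_pentagon_pages:
  "list_all (\<lambda>x. list_all (\<lambda>y. list_all (\<lambda>k.
     x = y \<or> pentagon_color (min x y) (max x y) = k \<or>
     length (filter (\<lambda>z. z \<noteq> x \<and> z \<noteq> y \<and> pentagon_color (min x z) (max x z) \<noteq> k \<and>
       pentagon_color (min y z) (max y z) \<noteq> k) [0..<10]) < 6)
     [1, 2, 3]) [0..<10]) [0..<10]"
  by code_simp

text \<open>Color 1 is the cut between the two blocks, so a triangle with an edge of color 1 has two.\<close>

lemma gallai_double_pentagon: "gallai_coloring 3 p double_pentagon"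
proof -
  have one: "double_pentagon {x, y} = 1 \<longleftrightarrow> (x < 5) \<noteq> (y < 5)" for x y
    unfolding double_pentagon_pair pentagon_color_def by (auto simp: min_def max_def)
  have any: "double_pentagon e = 1 \<or> double_pentagon e = 2 \<or> double_pentagon e = 3" for e
    by (simp add: double_pentagon_def pentagon_color_def)
  have pair: "double_pentagon {x, y} = double_pentagon {x, z} \<or>
      double_pentagon {x, y} = double_pentagon {y, z} \<or>
      double_pentagon {x, z} = double_pentagon {y, z}" for x y z
    using one[of x y] one[of x z] one[of y z]
      any[of "{x, y}"] any[of "{x, z}"] any[of "{y, z}"] by auto
  have "\<not> rainbow_triangle p double_pentagon"
  proof
    assume "rainbow_triangle p double_pentagon"
    then obtain x y z where "double_pentagon {x, y} \<noteq> double_pentagon {x, z}"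
      "double_pentagon {x, y} \<noteq> double_pentagon {y, z}"
      "double_pentagon {x, z} \<noteq> double_pentagon {y, z}"
      unfolding rainbow_triangle_def by (elim bexE conjE)
    then show False using pair[of x y z] by blast
  qed
  moreover have "coloring 3 p double_pentagon"
    unfolding coloring_def using double_pentagon_in by (rule Pi_I)
  ultimately show ?thesis unfolding gallai_coloring_def by blast
qed

lemma no_book_double_pentagon:
  assumes "p \<le> 10"
  shows "\<not> contains_with_colors 2 p double_pentagon (book 6)"
proof
  assume cont: "contains_with_colors 2 p double_pentagon (book 6)"
  have "coloring (Suc 2) p double_pentagon"
    using gallai_double_pentagon by (simp add: gallai_coloring_def)
  then obtain x y k where x: "x < p" and y: "y < p" and k: "k \<in> {1..Suc 2}" and "x \<noteq> y"
    and xy: "double_pentagon {x, y} \<noteq> k" and pages: "6 \<le> card (book_pages p double_pentagon k x y)"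
    using book_pages_if_contains[OF _ cont] by blast
  have mem: "x \<in> set [0..<10]" "y \<in> set [0..<10]" "k \<in> set [1, 2, 3]"
    using x y k assms by auto
  let ?zs = "filter (\<lambda>z. z \<noteq> x \<and> z \<noteq> y \<and> pentagon_color (min x z) (max x z) \<noteq> k \<and>
       pentagon_color (min y z) (max y z) \<noteq> k) [0..<10]"
  have "length ?zs < 6"
    using double_pentagon_pages[unfolded list_all_iff, rule_format, OF mem] \<open>x \<noteq> y\<close> xy
    by (simp only: double_pentagon_pair) blast
  \<comment> \<open>Pages among fewer vertices are pages among ten, so the one check covers every
    \<open>p \<le> 10\<close>.\<close>
  moreover have "book_pages p double_pentagon k x y \<subseteq> set ?zs"
    using assms by (auto simp: book_pages_def double_pentagon_pair)
  then have "card (book_pages p double_pentagon k x y) \<le> length ?zs"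
    by (meson card_length card_mono finite_set le_trans)
  ultimately show False using pages by simp
qed

theorem theorem4p2:
  shows "weakened_gallai_ramsey 3 2 (book 6) = 11"
  unfolding weakened_gallai_ramsey_def
proof (rule Least_equality)
  show "\<forall>f. gallai_coloring 3 11 f \<longrightarrow> contains_with_colors 2 11 f (book 6)"
    using contains_book_if_gallai_11 by blast
  show "11 \<le> p" if "\<forall>f. gallai_coloring 3 p f \<longrightarrow> contains_with_colors 2 p f (book 6)" for p
    using that gallai_double_pentagon[of p] no_book_double_pentagon[of p] by force
qed

end
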